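(* For each integer $m\geq 3$, there exists a $2$-$(m^2,m+1,\lambda)$ design (for some positive integer $\lambda$) admitting $\mathrm{S}_m\wr \mathrm{S}_2$ as a block-transitive, point-primitive group of automorphisms.
   Context: A $2$-$(v,k,\lambda)$ design ($v,k,\lambda$ positive integers) is a pair $(\mathcal{P},\mathcal{B})$ where $\mathcal{P}$ is a set of $v$ points and $\mathcal{B}$ is a set of $k$-element subsets of $\mathcal{P}$ (blocks) such that every $2$-element subset of $\mathcal{P}$ lies in exactly $\lambda$ blocks. A group of automorphisms is a permutation group on $\mathcal{P}$ preserving $\mathcal{B}$; it is block-transitive if it is transitive on $\mathcal{B}$, and point-primitive if it acts primitively on $\mathcal{P}$. $\mathrm{S}_m$ denotes the symmetric group of degree $m$, and $\mathrm{S}_m\wr\mathrm{S}_2=(\mathrm{S}_m\times \mathrm{S}_m)\rtimes \mathrm{S}_2$. *)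

theory Defs
  imports
    "HOL-Algebra.Sym_Groups"
    "HOL-Algebra.Group_Action"
    "HOL-Library.Disjoint_Sets"
begin

section \<open>Designs and their automorphisms\<close>

definition two_design :: "nat \<Rightarrow> nat \<Rightarrow> nat \<Rightarrow> 'a set \<Rightarrow> 'a set set \<Rightarrow> bool" where
  "two_design v k l P B \<longleftrightarrow>
     v > 0 \<and> k > 0 \<and> l > 0 \<and>
     finite P \<and> card P = v \<and>
     (\<forall>b\<in>B. b \<subseteq> P \<and> card b = k) \<and>
     (\<forall>S. S \<subseteq> P \<and> card S = 2 \<longrightarrow> card {b \<in> B. S \<subseteq> b} = l)"

abbreviation perm_group :: "'a set \<Rightarrow> ('a \<Rightarrow> 'a) set \<Rightarrow> ('a \<Rightarrow> 'a) monoid" where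
  "perm_group P G \<equiv> BijGroup P \<lparr> carrier := G \<rparr>"

definition automorphism_group :: "'a set \<Rightarrow> 'a set set \<Rightarrow> ('a \<Rightarrow> 'a) set \<Rightarrow> bool" where
  "automorphism_group P B G \<longleftrightarrow>
     subgroup G (BijGroup P) \<and> (\<forall>g\<in>G. (\<lambda>b. g ` b) ` B = B)"

text \<open>Elements of \<^const>\<open>BijGroup\<close> \<open>B\<close> are extensional, so the
  induced map on blocks is restricted to \<open>B\<close>.\<close>

definition block_transitive :: "'a set \<Rightarrow> 'a set set \<Rightarrow> ('a \<Rightarrow> 'a) set \<Rightarrow> bool" where
  "block_transitive P B G \<longleftrightarrow> transitive_action (perm_group P G) B (\<lambda>g. \<lambda>b\<in>B. g ` b)"

locale primitive_action = transitive_action +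
  assumes trivial_invariant_partition:
    "\<And>Q. \<lbrakk> partition_on E Q; \<And>g X. \<lbrakk> g \<in> carrier G; X \<in> Q \<rbrakk> \<Longrightarrow> \<phi> g ` X \<in> Q \<rbrakk>
       \<Longrightarrow> Q = {E} \<or> Q = (\<lambda>x. {x}) ` E"

definition point_primitive :: "'a set \<Rightarrow> ('a \<Rightarrow> 'a) set \<Rightarrow> bool" where
  "point_primitive P G \<longleftrightarrow> primitive_action (perm_group P G) P (\<lambda>g. g)"


section \<open>The wreath product of a symmetric group with the symmetric group of degree 2\<close>

definition semidirect_product ::
  "('a, 'c) monoid_scheme \<Rightarrow> ('b, 'd) monoid_scheme \<Rightarrow> ('b \<Rightarrow> 'a \<Rightarrow> 'a) \<Rightarrow> ('a \<times> 'b) monoid" where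
  "semidirect_product N H \<theta> =
     \<lparr> carrier = carrier N \<times> carrier H,
       mult = (\<lambda>(n, h) (n', h'). (n \<otimes>\<^bsub>N\<^esub> \<theta> h n', h \<otimes>\<^bsub>H\<^esub> h')),
       one = (\<one>\<^bsub>N\<^esub>, \<one>\<^bsub>H\<^esub>) \<rparr>"

text \<open>A permutation of \<open>{1, 2}\<close> permutes the two coordinates of a pair; it is the identity
  exactly if it fixes 1.\<close>

definition swap_coords :: "(nat \<Rightarrow> nat) \<Rightarrow> 'a \<times> 'a \<Rightarrow> 'a \<times> 'a" where
  "swap_coords s x = (if s 1 = 1 then x else (snd x, fst x))"

definition sym_wr_S2 :: "nat \<Rightarrow> (((nat \<Rightarrow> nat) \<times> (nat \<Rightarrow> nat)) \<times> (nat \<Rightarrow> nat)) monoid" where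
  "sym_wr_S2 m =
     semidirect_product (sym_group m \<times>\<times> sym_group m) (sym_group 2) swap_coords"

lemma permutes_two_cases:
  assumes "s permutes {1..2::nat}"
  obtains "s 1 = 1" "s 2 = 2" | "s 1 = 2" "s 2 = 1"
proof -
  have *: "s 1 \<in> {1..2}" "s 2 \<in> {1..2}"
    using permutes_in_image[OF assms, of 1] permutes_in_image[OF assms, of 2] by auto
  moreover have "s 1 \<noteq> s 2"
    using permutes_inj[OF assms] by (metis injD one_eq_numeral_iff semiring_norm(85))
  ultimately show thesis
    using that by (metis One_nat_def Suc_1 atLeastAtMost_iff le_Suc_eq le_antisym)
qed

lemma swap_coords_comp:
  assumes "s permutes {1..2}" "t permutes {1..2}"
  shows "swap_coords (s \<circ> t) x = swap_coords s (swap_coords t x)"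
  by (rule permutes_two_cases[OF assms(1)]; rule permutes_two_cases[OF assms(2)])
     (auto simp: swap_coords_def)

lemma group_sym_wr_S2: "group (sym_wr_S2 m)"
proof -
  let ?S = "sym_group m" and ?T = "sym_group 2"
  interpret S: group ?S by (rule sym_group_is_group)
  interpret T: group ?T by (rule sym_group_is_group)
  interpret N: group "?S \<times>\<times> ?S" by (rule DirProd_group) unfold_locales
  have swap_closed: "swap_coords s x \<in> carrier (?S \<times>\<times> ?S)"
    if "x \<in> carrier (?S \<times>\<times> ?S)" for s x
    using that by (auto simp: swap_coords_def)
  have swap_mult: "swap_coords s (x \<otimes>\<^bsub>?S \<times>\<times> ?S\<^esub> y) =
      swap_coords s x \<otimes>\<^bsub>?S \<times>\<times> ?S\<^esub> swap_coords s y" for s x y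
    by (cases x; cases y) (auto simp: swap_coords_def)
  have swap_hom: "swap_coords (s \<otimes>\<^bsub>?T\<^esub> t) x = swap_coords s (swap_coords t x)"
    if "s \<in> carrier ?T" "t \<in> carrier ?T" for s t and x :: "(nat \<Rightarrow> nat) \<times> (nat \<Rightarrow> nat)"
    using that swap_coords_comp by (simp add: sym_group_carrier sym_group_mult)
  have swap_one: "swap_coords \<one>\<^bsub>?T\<^esub> x = x" for x :: "(nat \<Rightarrow> nat) \<times> (nat \<Rightarrow> nat)"
    by (simp add: swap_coords_def sym_group_one)
  note carr = carrier_DirProd one_DirProd mult_DirProd
  show ?thesis
  proof (rule groupI, goal_cases)
    case (1 x y)
    then show ?case
      using swap_closed N.m_closed T.m_closed
      by (auto simp: sym_wr_S2_def semidirect_product_def simp del: carr)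
  next
    case 2
    show ?case
      using N.one_closed T.one_closed
      by (auto simp: sym_wr_S2_def semidirect_product_def simp del: carr)
  next
    case (3 x y z)
    obtain n h n' h' n'' h'' where xyz: "x = (n, h)" "y = (n', h')" "z = (n'', h'')"
      by (metis surj_pair)
    with 3 show ?case
      using swap_closed
      by (simp add: sym_wr_S2_def semidirect_product_def swap_mult swap_hom N.m_assoc T.m_assoc
          del: carr)
  next
    case (4 x)
    then show ?case
      by (auto simp: sym_wr_S2_def semidirect_product_def swap_one simp del: carr)
  next
    case (5 x)
    then obtain n h where x: "x = (n, h)"
      and n: "n \<in> carrier (?S \<times>\<times> ?S)" and h: "h \<in> carrier ?T"
      by (auto simp: sym_wr_S2_def semidirect_product_def simp del: carr)
    from T.l_inv_ex[OF h] obtain k where k: "k \<in> carrier ?T" "k \<otimes>\<^bsub>?T\<^esub> h = \<one>\<^bsub>?T\<^esub>"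
      by blast
    let ?y = "(inv\<^bsub>?S \<times>\<times> ?S\<^esub> (swap_coords k n), k)"
    have "?y \<in> carrier (sym_wr_S2 m)"
      using k swap_closed[OF n] N.inv_closed
      by (simp add: sym_wr_S2_def semidirect_product_def del: carr)
    moreover have "?y \<otimes>\<^bsub>sym_wr_S2 m\<^esub> x = \<one>\<^bsub>sym_wr_S2 m\<^esub>"
      using k swap_closed[OF n]
      by (simp add: x sym_wr_S2_def semidirect_product_def N.l_inv del: carr)
    ultimately show ?case by blast
  qed
qed

end

(* The product action of S_m wr S_2 on the m x m grid has two orbitals: collinear and
   non-collinear pairs of points.  By double counting, the orbit of a block of size m + 1 is a
   2-design as soon as the block meets both orbitals in proportion to their sizes, which means
   that it contains exactly m collinear pairs.  A staircase of m + 1 points, moving alternately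
   along rows and columns, has this property because only consecutive points are collinear. *)

theory Submission
  imports Defs "HOL-Library.Nat_Bijection"
begin

section \<open>Orbits of blocks under a group action\<close>

text \<open>Of the m^2 - 1 points other than a given one, 2(m - 1) are collinear with it, a fraction
  of 2/(m + 1). A block of m + 1 points has m(m + 1)/2 pairs, and this fraction of them is m: hence
  the required number of collinear pairs. All counting uses ordered pairs, so a block must contain
  2m collinear and m(m - 1) non-collinear ones. Primitivity is what excludes m = 2: in the 2 x 2
  grid each point has exactly one non-collinear partner, and these couples form an invariant
  partition. The action arises as a homomorphism from the abstract semidirect product, whereas the
  theorem asks for a set \<open>G\<close> of permutations of natural numbers. The action is
  therefore carried along an injection into \<open>nat\<close>, and \<open>G\<close> is the image of
  the resulting homomorphism; faithfulness makes this image isomorphic to the wreath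
  product.\<close>

context group_action
begin

lemma group_axiom: "group G"
  using group_hom by (rule group_hom.axioms(1))

lemma action_one: "x \<in> E \<Longrightarrow> \<phi> \<one> x = x"
  using id_eq_one by (metis restrict_apply')

lemma action_inv_cancel:
  assumes "g \<in> carrier G" "x \<in> E"
  shows "\<phi> g (\<phi> (inv g) x) = x" "\<phi> (inv g) (\<phi> g x) = x"
proof -
  interpret G: group G by (rule group_axiom)
  show "\<phi> g (\<phi> (inv g) x) = x" "\<phi> (inv g) (\<phi> g x) = x"
    using assms composition_rule[of x g "inv g"] composition_rule[of x "inv g" g]
    by (simp_all add: action_one)
qed

definition block_orbit :: "'c set \<Rightarrow> 'c set set" where
  "block_orbit b = (\<lambda>g. \<phi> g ` b) ` carrier G"

lemma block_orbit_refl: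
  assumes "b \<subseteq> E"
  shows "b \<in> block_orbit b"
proof -
  interpret G: group G by (rule group_axiom)
  have "\<phi> \<one> ` b = b"
    using assms by (auto simp: action_one subset_iff image_iff)
  then show ?thesis unfolding block_orbit_def by (metis G.one_closed image_eqI)
qed

lemma block_orbit_image:
  assumes "b \<subseteq> E" "g \<in> carrier G" "c \<in> block_orbit b"
  shows "\<phi> g ` c \<in> block_orbit b"
proof -
  interpret G: group G by (rule group_axiom)
  obtain h where h: "h \<in> carrier G" "c = \<phi> h ` b"
    using assms(3) unfolding block_orbit_def by blast
  have "\<phi> g ` c = \<phi> (g \<otimes> h) ` b"
    unfolding h(2) image_image using composition_rule[OF _ assms(2) h(1)] assms(1)
    by (intro image_cong) auto
  then show ?thesis
    using assms(2) h(1) unfolding block_orbit_def by blast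
qed

lemma block_orbit_subset:
  assumes "b \<subseteq> E" "c \<in> block_orbit b"
  shows "c \<subseteq> E"
  using assms surj_prop unfolding block_orbit_def by blast

section \<open>Counting pairs and blocks in an orbit of blocks\<close>

lemma image_inv_cancel:
  assumes "g \<in> carrier G" "c \<subseteq> E"
  shows "\<phi> g ` \<phi> (inv g) ` c = c" "\<phi> (inv g) ` \<phi> g ` c = c"
  using assms action_inv_cancel by (force simp: image_image subset_iff)+

text \<open>Taking images under \<open>g\<close> permutes the orbit and sends blocks through
  \<open>S\<close> to blocks through the image of \<open>S\<close>; images under
  \<open>inv g\<close> undo this.\<close>

lemma card_block_orbit_contains:
  assumes b: "b \<subseteq> E" and g: "g \<in> carrier G" and S: "S \<subseteq> E"
  shows "card {c \<in> block_orbit b. \<phi> g ` S \<subseteq> c} = card {c \<in> block_orbit b. S \<subseteq> c}"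
proof -
  interpret G: group G by (rule group_axiom)
  have "bij_betw ((`) (\<phi> g)) {c \<in> block_orbit b. S \<subseteq> c} {c \<in> block_orbit b. \<phi> g ` S \<subseteq> c}"
  proof (rule bij_betw_byWitness[where f' = "(`) (\<phi> (inv g))"])
    show "(`) (\<phi> (inv g)) ` {c \<in> block_orbit b. \<phi> g ` S \<subseteq> c} \<subseteq> {c \<in> block_orbit b. S \<subseteq> c}"
    proof clarsimp
      fix c assume c: "c \<in> block_orbit b" "\<phi> g ` S \<subseteq> c"
      have "\<phi> (inv g) ` \<phi> g ` S \<subseteq> \<phi> (inv g) ` c"
        using c(2) by (rule image_mono)
      then show "\<phi> (inv g) ` c \<in> block_orbit b \<and> S \<subseteq> \<phi> (inv g) ` c"
        using image_inv_cancel[OF g S] block_orbit_image[OF b _ c(1)] g by simp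
    qed
  qed (use image_inv_cancel[OF g block_orbit_subset[OF b]] block_orbit_image[OF b g] in auto)
  then show ?thesis by (rule bij_betw_same_card[symmetric])
qed

text \<open>Every block is a translate of \<open>b\<close>, and the translating element, acting on
  both entries of a pair, matches the \<open>\<Delta>\<close>-pairs of \<open>b\<close> with those
  of the translate.\<close>

lemma card_pairs_in_block:
  assumes b: "b \<subseteq> E" and \<Delta>: "\<Delta> \<subseteq> E \<times> E"
    and inv: "\<And>g. g \<in> carrier G \<Longrightarrow> map_prod (\<phi> g) (\<phi> g) ` \<Delta> \<subseteq> \<Delta>"
    and c: "c \<in> block_orbit b"
  shows "card (\<Delta> \<inter> c \<times> c) = card (\<Delta> \<inter> b \<times> b)"
proof -
  interpret G: group G by (rule group_axiom)
  obtain g where g: "g \<in> carrier G" "c = \<phi> g ` b"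
    using c unfolding block_orbit_def by blast
  have cancel: "\<phi> (inv g) (\<phi> g x) = x" "\<phi> g (\<phi> (inv g) x) = x" if "x \<in> E" for x
    using action_inv_cancel[OF g(1) that] by simp_all
  have img: "(\<phi> h x, \<phi> h y) \<in> \<Delta>" if "h \<in> carrier G" "(x, y) \<in> \<Delta>" for h x y
    using inv[OF that(1)] that(2) by force
  have ginv: "inv g \<in> carrier G" using g(1) by simp
  have c_eq: "\<phi> (inv g) x \<in> b" if "x \<in> c" for x
    using that cancel(1) b unfolding g(2) by auto
  have "bij_betw (map_prod (\<phi> g) (\<phi> g)) (\<Delta> \<inter> b \<times> b) (\<Delta> \<inter> c \<times> c)"
  proof (rule bij_betw_byWitness[where f' = "map_prod (\<phi> (inv g)) (\<phi> (inv g))"])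
    show "map_prod (\<phi> (inv g)) (\<phi> (inv g)) ` (\<Delta> \<inter> c \<times> c) \<subseteq> \<Delta> \<inter> b \<times> b"
      using img[OF ginv] c_eq by auto
    show "map_prod (\<phi> g) (\<phi> g) ` (\<Delta> \<inter> b \<times> b) \<subseteq> \<Delta> \<inter> c \<times> c"
      using img[OF g(1)] unfolding g(2) by auto
    show "\<forall>p\<in>\<Delta> \<inter> b \<times> b. map_prod (\<phi> (inv g)) (\<phi> (inv g)) (map_prod (\<phi> g) (\<phi> g) p) = p"
      using cancel(1) \<Delta> by auto
    show "\<forall>p\<in>\<Delta> \<inter> c \<times> c. map_prod (\<phi> g) (\<phi> g) (map_prod (\<phi> (inv g)) (\<phi> (inv g)) p) = p"
      using cancel(2) \<Delta> by auto
  qed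
  then show ?thesis by (rule bij_betw_same_card[symmetric])
qed

text \<open>Double counting of incidences between pairs in \<open>\<Delta>\<close> and blocks
  containing both entries. Transitivity on \<open>\<Delta>\<close> makes the number of blocks per
  pair constant; invariance of \<open>\<Delta>\<close> makes the number of pairs per block
  constant.\<close>

lemma orbital_count:
  assumes fin: "finite E" and b: "b \<subseteq> E" and \<Delta>: "\<Delta> \<subseteq> E \<times> E"
    and inv: "\<And>g. g \<in> carrier G \<Longrightarrow> map_prod (\<phi> g) (\<phi> g) ` \<Delta> \<subseteq> \<Delta>"
    and trans: "\<And>p q. p \<in> \<Delta> \<Longrightarrow> q \<in> \<Delta> \<Longrightarrow> \<exists>g\<in>carrier G. map_prod (\<phi> g) (\<phi> g) p = q"
    and xy: "(x, y) \<in> \<Delta>"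
  shows "card {c \<in> block_orbit b. {x, y} \<subseteq> c} * card \<Delta> =
         card (block_orbit b) * card (\<Delta> \<inter> b \<times> b)"
proof -
  let ?B = "block_orbit b"
  have finB: "finite ?B"
    using fin block_orbit_subset[OF b] by (meson Pow_iff finite_Pow_iff finite_subset subsetI)
  have fin\<Delta>: "finite \<Delta>"
    using fin \<Delta> by (meson finite_SigmaI finite_subset)
  have const: "card {c \<in> ?B. {fst p, snd p} \<subseteq> c} = card {c \<in> ?B. {x, y} \<subseteq> c}"
    if p: "p \<in> \<Delta>" for p
  proof -
    obtain g where g: "g \<in> carrier G" "map_prod (\<phi> g) (\<phi> g) (x, y) = p"
      using trans[OF xy p] by blast
    then show ?thesis
      using card_block_orbit_contains[OF b g(1), of "{x, y}"] xy \<Delta> by auto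
  qed
  have "card {c \<in> ?B. {x, y} \<subseteq> c} * card \<Delta> = (\<Sum>p\<in>\<Delta>. card {c \<in> ?B. {fst p, snd p} \<subseteq> c})"
    using const by (simp add: mult.commute)
  also have "\<dots> = (\<Sum>c\<in>?B. card {p \<in> \<Delta>. {fst p, snd p} \<subseteq> c})"
    by (rule sum_multicount_gen[OF fin\<Delta> finB]) simp
  also have "\<dots> = (\<Sum>c\<in>?B. card (\<Delta> \<inter> c \<times> c))"
    by (intro sum.cong arg_cong[where f = card]) auto
  also have "\<dots> = card ?B * card (\<Delta> \<inter> b \<times> b)"
    using card_pairs_in_block[OF b \<Delta> inv] by simp
  finally show ?thesis .
qed

lemma card_block_orbit_member:
  assumes "b \<subseteq> E" "c \<in> block_orbit b"
  shows "card c = card b"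
proof -
  obtain g where "g \<in> carrier G" "c = \<phi> g ` b"
    using assms(2) unfolding block_orbit_def by blast
  then show ?thesis
    using inj_on_subset[OF inj_prop assms(1)] by (simp add: card_image)
qed

section \<open>The permutation group induced by a group action\<close>

lemma subgroup_image: "subgroup (\<phi> ` carrier G) (BijGroup E)"
  using group_hom by (rule group_hom.img_is_subgroup)

text \<open>Block-transitivity and point-primitivity are stated for a permutation group in its
  natural action, so the inclusion of the image of \<open>\<phi>\<close> must itself be recognised
  as an action.\<close>

lemma group_hom_perm_group_id: "group_hom (perm_group E (\<phi> ` carrier G)) (BijGroup E) (\<lambda>g. g)"
proof -
  interpret B: group "BijGroup E" by (rule group_BijGroup)
  show ?thesis
    using B.canonical_inj_is_hom[OF subgroup_image] by (simp add: id_def)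
qed

lemma automorphism_group_block_orbit:
  assumes b: "b \<subseteq> E"
  shows "automorphism_group E (block_orbit b) (\<phi> ` carrier G)"
proof -
  interpret G: group G by (rule group_axiom)
  have "(`) (\<phi> g) ` block_orbit b = block_orbit b" if g: "g \<in> carrier G" for g
  proof
    show "block_orbit b \<subseteq> (`) (\<phi> g) ` block_orbit b"
    proof
      fix c assume c: "c \<in> block_orbit b"
      show "c \<in> (`) (\<phi> g) ` block_orbit b"
      proof (rule image_eqI)
        show "c = \<phi> g ` \<phi> (inv g) ` c"
          using image_inv_cancel(1)[OF g block_orbit_subset[OF b c]] by simp
        show "\<phi> (inv g) ` c \<in> block_orbit b"
          using block_orbit_image[OF b _ c] g by simp
      qed
    qed
    show "(`) (\<phi> g) ` block_orbit b \<subseteq> block_orbit b"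
      using block_orbit_image[OF b g] by (rule image_subsetI)
  qed
  then show ?thesis
    using subgroup_image by (simp add: automorphism_group_def)
qed

lemma block_transitive_block_orbit:
  assumes b: "b \<subseteq> E"
  shows "block_transitive E (block_orbit b) (\<phi> ` carrier G)"
proof -
  interpret G: group G by (rule group_axiom)
  let ?B = "block_orbit b" and ?H = "\<phi> ` carrier G"
  let ?\<beta> = "\<lambda>g. \<lambda>c\<in>?B. g ` c"
  have grp: "group (perm_group E ?H)"
    using group_hom_perm_group_id by (rule group_hom.axioms(1))
  have im: "(`) g ` ?B = ?B" if "g \<in> ?H" for g
    using automorphism_group_block_orbit[OF b] that unfolding automorphism_group_def by blast
  have inj: "inj_on ((`) g) ?B" if "g \<in> ?H" for g
  proof -
    have "inj_on ((`) g) (Pow E)"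
      using that inj_prop by (auto intro: inj_on_image_Pow)
    then show ?thesis
      by (rule inj_on_subset) (use block_orbit_subset[OF b] in auto)
  qed
  \<comment> \<open>Membership in \<open>Bij\<close> demands an extensional function as well as a
    bijection, which is why the map on blocks carries a restriction.\<close>
  have Bij: "?\<beta> g \<in> Bij ?B" if "g \<in> ?H" for g
    using im[OF that] inj[OF that] by (simp add: Bij_def bij_betw_def)
  have mult: "?\<beta> (g \<otimes>\<^bsub>BijGroup E\<^esub> h) = ?\<beta> g \<otimes>\<^bsub>BijGroup ?B\<^esub> ?\<beta> h" if "g \<in> ?H" "h \<in> ?H" for g h
  proof -
    have "g \<in> Bij E" "h \<in> Bij E"
      using that bij_prop0 by auto
    then have "g \<otimes>\<^bsub>BijGroup E\<^esub> h = compose E g h"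
      by (simp add: BijGroup_def)
    moreover have "compose E g h ` c = g ` h ` c" if "c \<in> ?B" for c
      unfolding image_image using block_orbit_subset[OF b that]
      by (intro image_cong refl compose_eq) blast
    moreover have "h ` c \<in> ?B" if "c \<in> ?B" for c
      using im[OF \<open>h \<in> ?H\<close>] that by blast
    ultimately have "?\<beta> (g \<otimes>\<^bsub>BijGroup E\<^esub> h) = compose ?B (?\<beta> g) (?\<beta> h)"
      by (intro extensionalityI[of _ ?B]) (simp_all add: compose_eq)
    then show ?thesis
      using Bij[OF that(1)] Bij[OF that(2)]
      by (simp add: BijGroup_def)
  qed
  have "group_hom (perm_group E ?H) (BijGroup ?B) ?\<beta>"
    using grp group_BijGroup[of ?B] Bij mult
    by (auto simp: group_hom_def group_hom_axioms_def hom_def BijGroup_def)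
  moreover have "\<exists>g\<in>?H. ?\<beta> g c = d" if c: "c \<in> ?B" and d: "d \<in> ?B" for c d
  proof -
    obtain g where g: "g \<in> carrier G" "c = \<phi> g ` b"
      using c unfolding block_orbit_def by blast
    obtain h where h: "h \<in> carrier G" "d = \<phi> h ` b"
      using d unfolding block_orbit_def by blast
    \<comment> \<open>Both blocks are translates of \<open>b\<close>: go back from \<open>c\<close>
      to \<open>b\<close> by \<open>inv g\<close>, then on to \<open>d\<close> by
      \<open>h\<close>.\<close>
    have "\<phi> (h \<otimes> inv g) ` c = \<phi> h ` \<phi> (inv g) ` c"
      using composition_rule[of _ h "inv g"] g h block_orbit_subset[OF b c]
      by (auto simp: image_image intro!: image_cong)
    then have "?\<beta> (\<phi> (h \<otimes> inv g)) c = d"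
      using c g h image_inv_cancel(2)[OF g(1) b] by simp
    then show ?thesis using g h by blast
  qed
  ultimately show ?thesis
    by (simp add: block_transitive_def transitive_action_def transitive_action_axioms_def
        group_action_def)
qed

end

text \<open>Faithfulness is injectivity of \<open>\<phi>\<close>, so \<open>\<phi>\<close> is an
  isomorphism onto its image.\<close>

lemma (in faithful_action) perm_group_image_iso: "perm_group E (\<phi> ` carrier G) \<cong> G"
proof -
  interpret G: group G by (rule group_axiom)
  have "\<phi> \<in> iso G (perm_group E (\<phi> ` carrier G))"
    using faithful group_hom.homh[OF group_hom] by (auto simp: iso_def hom_def bij_betw_def)
  then have "G \<cong> perm_group E (\<phi> ` carrier G)"
    by (auto simp: is_iso_def)
  then show ?thesis by (rule G.iso_sym)
qed

lemma (in primitive_action) point_primitive_image: "point_primitive E (\<phi> ` carrier G)"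
  using group_hom_perm_group_id unique_orbit trivial_invariant_partition
  by (auto simp: point_primitive_def primitive_action_def primitive_action_axioms_def
      transitive_action_def transitive_action_axioms_def group_action_def)

section \<open>Transport of actions and designs along injections\<close>

text \<open>Conjugation of the action by \<open>e\<close>. The restriction keeps the result
  extensional, as elements of \<open>BijGroup\<close> have to be.\<close>

definition transport_action :: "('c \<Rightarrow> 'd) \<Rightarrow> 'c set \<Rightarrow> ('a \<Rightarrow> 'c \<Rightarrow> 'c) \<Rightarrow> 'a \<Rightarrow> 'd \<Rightarrow> 'd" where
  "transport_action e E \<phi> g = (\<lambda>y\<in>e ` E. e (\<phi> g (inv_into E e y)))"

lemma transport_action_apply:
  assumes "inj_on e E" "x \<in> E"
  shows "transport_action e E \<phi> g (e x) = e (\<phi> g x)"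
  using assms by (simp add: transport_action_def)

lemma group_action_transport:
  assumes "group_action G E \<phi>" and e: "inj_on e E"
  shows "group_action G (e ` E) (transport_action e E \<phi>)"
proof -
  interpret group_action G E \<phi> by fact
  interpret G: group G by (rule group_axiom)
  let ?\<psi> = "transport_action e E \<phi>"
  note app = transport_action_apply[OF e]
  have Bij: "?\<psi> g \<in> Bij (e ` E)" if g: "g \<in> carrier G" for g
  proof -
    have "bij_betw (e \<circ> (\<phi> g \<circ> inv_into E e)) (e ` E) (e ` E)"
      using e inj_prop[OF g] surj_prop[OF g]
      by (intro bij_betw_trans[of _ _ E]) (auto simp: bij_betw_def inj_on_inv_into)
    then show ?thesis
      by (simp add: Bij_def transport_action_def o_def)
  qed
  have "?\<psi> (g \<otimes>\<^bsub>G\<^esub> h) = ?\<psi> g \<otimes>\<^bsub>BijGroup (e ` E)\<^esub> ?\<psi> h"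
    if g: "g \<in> carrier G" and h: "h \<in> carrier G" for g h
  proof -
    have "?\<psi> (g \<otimes>\<^bsub>G\<^esub> h) = compose (e ` E) (?\<psi> g) (?\<psi> h)"
    proof (rule extensionalityI)
      fix y assume "y \<in> e ` E"
      then obtain x where x: "x \<in> E" "y = e x" by blast
      moreover have "\<phi> h x \<in> E" using element_image[OF h x(1)] by simp
      ultimately show "?\<psi> (g \<otimes>\<^bsub>G\<^esub> h) y = compose (e ` E) (?\<psi> g) (?\<psi> h) y"
        using composition_rule[OF x(1) g h] by (simp add: compose_def app)
    qed (auto simp: transport_action_def)
    then show ?thesis
      using Bij[OF g] Bij[OF h] by (simp add: BijGroup_def)
  qed
  with Bij show ?thesis
    using G.group_axioms group_BijGroup[of "e ` E"]
    by (auto simp: group_action_def group_hom_def group_hom_axioms_def hom_def BijGroup_def)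
qed

lemma faithful_action_transport:
  assumes "faithful_action G E \<phi>" and e: "inj_on e E"
  shows "faithful_action G (e ` E) (transport_action e E \<phi>)"
proof -
  interpret faithful_action G E \<phi> by fact
  have "inj_on (transport_action e E \<phi>) (carrier G)"
  proof (rule inj_onI)
    fix g h assume g: "g \<in> carrier G" and h: "h \<in> carrier G"
      and eq: "transport_action e E \<phi> g = transport_action e E \<phi> h"
    have "\<phi> g x = \<phi> h x" if x: "x \<in> E" for x
      using fun_cong[OF eq, of "e x"] e x element_image[OF g x] element_image[OF h x]
      by (auto simp: transport_action_apply dest: inj_onD)
    \<comment> \<open>Agreement on \<open>E\<close> suffices because both functions are extensional
      there.\<close>
    then have "\<phi> g = \<phi> h"
      using bij_prop0[OF g] bij_prop0[OF h]
      by (intro extensionalityI[of _ E]) (auto simp: Bij_def)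
    with faithful show "g = h" using g h by (rule inj_onD)
  qed
  then show ?thesis
    using group_action_transport[OF group_action_axioms e]
    by (simp add: faithful_action_def faithful_action_axioms_def)
qed

text \<open>An invariant partition of the image pulls back along \<open>e\<close> to an invariant
  partition of \<open>E\<close>; that one is trivial, and pushing it forward again recovers the
  original.\<close>

lemma primitive_action_transport:
  assumes "primitive_action G E \<phi>" and e: "inj_on e E"
  shows "primitive_action G (e ` E) (transport_action e E \<phi>)"
proof -
  interpret primitive_action G E \<phi> by fact
  let ?\<psi> = "transport_action e E \<phi>"
  note app = transport_action_apply[OF e]
  have trans: "\<exists>g\<in>carrier G. ?\<psi> g y = z" if "y \<in> e ` E" "z \<in> e ` E" for y z
  proof -
    obtain x w where "x \<in> E" "w \<in> E" "y = e x" "z = e w" using \<open>y \<in> e ` E\<close> \<open>z \<in> e ` E\<close> by blast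
    then show ?thesis using unique_orbit[of x w] app by metis
  qed
  have prim: "Q = {e ` E} \<or> Q = (\<lambda>x. {x}) ` e ` E"
    if Q: "partition_on (e ` E) Q"
      and inv: "\<And>g X. g \<in> carrier G \<Longrightarrow> X \<in> Q \<Longrightarrow> ?\<psi> g ` X \<in> Q" for Q
  proof -
    define d where "d = inv_into E e"
    have de: "d ` e ` Z = Z" if "Z \<subseteq> E" for Z
      unfolding d_def using e that by (rule inv_into_image_cancel)
    have ed: "e ` d ` X = X" if "X \<in> Q" for X
    proof -
      have "X \<subseteq> e ` E" using partition_onD1[OF Q] that by blast
      then show ?thesis unfolding d_def by (rule image_inv_into_cancel[OF refl])
    qed
    have part: "partition_on E ((`) d ` Q)"
    proof -
      have "inj_on d (e ` E)" by (simp add: d_def inj_on_inv_into)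
      then have "partition_on (d ` e ` E) ((`) d ` Q - {{}})"
        using Q by (intro partition_on_inj_image)
      moreover have "d ` e ` E = E" using de by blast
      \<comment> \<open>The library fact about injective images discards a possible empty part; the
        parts of \<open>Q\<close> are non-empty, so nothing is lost.\<close>
      moreover have "(`) d ` Q - {{}} = (`) d ` Q" using partition_onD3[OF Q] by auto
      ultimately show ?thesis by simp
    qed
    have "\<phi> g ` X \<in> (`) d ` Q" if g: "g \<in> carrier G" and X: "X \<in> (`) d ` Q" for g X
    proof -
      obtain Y where Y: "Y \<in> Q" "X = d ` Y" using X by blast
      have XE: "X \<subseteq> E" using partition_onD1[OF part] X by blast
      have "?\<psi> g ` Y = e ` \<phi> g ` X"
      proof -
        have "?\<psi> g ` e ` X = e ` \<phi> g ` X"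
          unfolding image_image using XE by (intro image_cong refl app) auto
        then show ?thesis using ed[OF Y(1)] Y(2) by simp
      qed
      then have "d ` ?\<psi> g ` Y = \<phi> g ` X"
        using de[of "\<phi> g ` X"] image_mono[OF XE, of "\<phi> g"] surj_prop[OF g] by simp
      then show ?thesis using inv[OF g Y(1)] by (metis imageI)
    qed
    from trivial_invariant_partition[OF part this]
    have triv: "(`) d ` Q = {E} \<or> (`) d ` Q = (\<lambda>x. {x}) ` E" .
    have Q_eq: "Q = (`) e ` (`) d ` Q" using ed unfolding image_image by simp
    from triv show ?thesis
    proof
      assume "(`) d ` Q = {E}"
      with Q_eq show ?thesis by simp
    next
      assume "(`) d ` Q = (\<lambda>x. {x}) ` E"
      with Q_eq have "Q = (`) e ` (\<lambda>x. {x}) ` E" by simp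
      then show ?thesis by (simp only: image_image image_insert image_empty simp_thms)
    qed
  qed
  show ?thesis
    using group_action_transport[OF group_action_axioms e] trans prim
    unfolding primitive_action_def primitive_action_axioms_def transitive_action_def
      transitive_action_axioms_def by blast
qed

lemma two_design_transport:
  assumes D: "two_design v k l P B" and e: "inj_on e P"
  shows "two_design v k l (e ` P) ((`) e ` B)"
proof -
  have BP: "b \<subseteq> P" if "b \<in> B" for b using D that by (simp add: two_design_def)
  have inj: "inj_on ((`) e) B"
    using inj_on_image_Pow[OF e] by (rule inj_on_subset) (use BP in auto)
  have "card {c \<in> (`) e ` B. S \<subseteq> c} = l" if S: "S \<subseteq> e ` P" "card S = 2" for S
  proof -
    obtain T where T: "T \<subseteq> P" "S = e ` T" using S(1) by (meson subset_imageE)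
    have "card T = 2" using S(2) T e by (metis card_image inj_on_subset)
    then have "card {b \<in> B. T \<subseteq> b} = l" using D T(1) by (simp add: two_design_def)
    moreover have "{c \<in> (`) e ` B. S \<subseteq> c} = (`) e ` {b \<in> B. T \<subseteq> b}"
    proof -
      have "e ` T \<subseteq> e ` b \<longleftrightarrow> T \<subseteq> b" if "b \<in> B" for b
      proof
        assume sub: "e ` T \<subseteq> e ` b"
        show "T \<subseteq> b"
        proof
          fix x assume "x \<in> T"
          then have "x \<in> P" "e x \<in> e ` b" using T(1) sub by blast+
          then show "x \<in> b" using inj_on_image_mem_iff[OF e _ BP[OF that]] by simp
        qed
      qed (rule image_mono)
      then show ?thesis using T(2) by auto
    qed
    ultimately show ?thesis
      using inj by (metis (no_types, lifting) card_image inj_on_subset mem_Collect_eq subsetI)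
  qed
  then show ?thesis
    using D inj_on_subset[OF e BP] e image_mono[OF BP, of _ e] unfolding two_design_def
    by (simp add: card_image)
qed

lemma block_orbit_transport:
  assumes "group_action G E \<phi>" and e: "inj_on e E" and b: "b \<subseteq> E"
  shows "group_action.block_orbit G (transport_action e E \<phi>) (e ` b) =
         (`) e ` group_action.block_orbit G \<phi> b"
proof -
  interpret group_action G E \<phi> by fact
  have "transport_action e E \<phi> g ` e ` b = e ` \<phi> g ` b" for g
    unfolding image_image using b by (intro image_cong refl transport_action_apply[OF e]) auto
  then show ?thesis
    by (simp add: group_action.block_orbit_def[OF group_action_transport[OF group_action_axioms e]]
        block_orbit_def image_image)
qed


section \<open>The product action on the grid\<close>

definition grid :: "nat \<Rightarrow> (nat \<times> nat) set" where
  "grid m = {1..m} \<times> {1..m}"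

text \<open>On distinct points this is adjacency in the rook's graph. Every point is collinear with
  itself, so the diagonal has to be excluded separately when orbitals are formed.\<close>

definition collinear :: "nat \<times> nat \<Rightarrow> nat \<times> nat \<Rightarrow> bool" where
  "collinear p q \<longleftrightarrow> fst p = fst q \<or> snd p = snd q"

text \<open>The product action: the coordinates are exchanged before the base group acts. This order
  agrees with the multiplication of \<open>semidirect_product\<close>, where \<open>h\<close> twists
  the second base element \<open>n'\<close>.\<close>

definition grid_map :: "((nat \<Rightarrow> nat) \<times> (nat \<Rightarrow> nat)) \<times> (nat \<Rightarrow> nat) \<Rightarrow> nat \<times> nat \<Rightarrow> nat \<times> nat" where
  "grid_map x p = map_prod (fst (fst x)) (snd (fst x)) (swap_coords (snd x) p)"

definition grid_action ::
  "nat \<Rightarrow> ((nat \<Rightarrow> nat) \<times> (nat \<Rightarrow> nat)) \<times> (nat \<Rightarrow> nat) \<Rightarrow> nat \<times> nat \<Rightarrow> nat \<times> nat" where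
  "grid_action m x = restrict (grid_map x) (grid m)"

lemma sym_wr_S2_carrier:
  "((\<sigma>, \<tau>), h) \<in> carrier (sym_wr_S2 m) \<longleftrightarrow>
     \<sigma> permutes {1..m} \<and> \<tau> permutes {1..m} \<and> h permutes {1..2}"
  by (auto simp: sym_wr_S2_def semidirect_product_def sym_group_carrier)

lemma finite_grid: "finite (grid m)"
  by (simp add: grid_def)

lemma card_grid: "card (grid m) = m ^ 2"
  by (simp add: grid_def power2_eq_square)

lemma grid_map_mult:
  assumes "x \<in> carrier (sym_wr_S2 m)" "y \<in> carrier (sym_wr_S2 m)"
  shows "grid_map (x \<otimes>\<^bsub>sym_wr_S2 m\<^esub> y) p = grid_map x (grid_map y p)"
proof -
  obtain \<sigma> \<tau> h \<sigma>' \<tau>' h' where xy: "x = ((\<sigma>, \<tau>), h)" "y = ((\<sigma>', \<tau>'), h')"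
    by (metis surj_pair)
  then have "h permutes {1..2}" "h' permutes {1..2}"
    using assms by (auto simp: sym_wr_S2_carrier)
  then have "swap_coords (h \<circ> h') p = swap_coords h (swap_coords h' p)"
    by (rule swap_coords_comp)
  then show ?thesis
    by (simp add: xy grid_map_def sym_wr_S2_def semidirect_product_def sym_group_mult
        swap_coords_def map_prod_def split: prod.splits)
qed

lemma grid_map_in_grid:
  assumes "x \<in> carrier (sym_wr_S2 m)" "p \<in> grid m"
  shows "grid_map x p \<in> grid m"
proof -
  obtain \<sigma> \<tau> h where x: "x = ((\<sigma>, \<tau>), h)" by (metis surj_pair)
  then have "\<sigma> permutes {1..m}" "\<tau> permutes {1..m}"
    using assms by (auto simp: sym_wr_S2_carrier)
  then have "\<And>i. \<sigma> i \<in> {1..m} \<longleftrightarrow> i \<in> {1..m}" "\<And>i. \<tau> i \<in> {1..m} \<longleftrightarrow> i \<in> {1..m}"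
    by (simp_all only: permutes_in_image)
  then show ?thesis
    using assms(2) by (cases p) (simp add: x grid_map_def grid_def swap_coords_def)
qed

lemma inj_grid_map:
  assumes "x \<in> carrier (sym_wr_S2 m)"
  shows "inj (grid_map x)"
proof -
  obtain \<sigma> \<tau> h where x: "x = ((\<sigma>, \<tau>), h)" by (metis surj_pair)
  then have "inj \<sigma>" "inj \<tau>"
    using assms by (auto simp: sym_wr_S2_carrier intro: permutes_inj)
  then show ?thesis
    by (intro injI) (simp add: x grid_map_def swap_coords_def prod_eq_iff inj_eq split: if_splits)
qed

lemma grid_action_Bij:
  assumes "x \<in> carrier (sym_wr_S2 m)"
  shows "grid_action m x \<in> Bij (grid m)"
proof -
  have "inj_on (grid_map x) (grid m)"
    using inj_grid_map[OF assms] by (rule inj_on_subset) simp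
  moreover from this have "grid_map x ` grid m = grid m"
    using grid_map_in_grid[OF assms] by (intro endo_inj_surj finite_grid) auto
  ultimately show ?thesis
    by (simp add: Bij_def grid_action_def bij_betw_def)
qed

lemma group_action_grid: "group_action (sym_wr_S2 m) (grid m) (grid_action m)"
proof -
  have "grid_action m (x \<otimes>\<^bsub>sym_wr_S2 m\<^esub> y) =
      grid_action m x \<otimes>\<^bsub>BijGroup (grid m)\<^esub> grid_action m y"
    if x: "x \<in> carrier (sym_wr_S2 m)" and y: "y \<in> carrier (sym_wr_S2 m)" for x y
  proof -
    have "grid_action m (x \<otimes>\<^bsub>sym_wr_S2 m\<^esub> y) =
        compose (grid m) (grid_action m x) (grid_action m y)"
      using grid_map_mult[OF x y] grid_map_in_grid[OF y]
      by (auto simp: grid_action_def compose_def intro!: restrict_ext)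
    then show ?thesis
      using grid_action_Bij[OF x] grid_action_Bij[OF y] by (simp add: BijGroup_def)
  qed
  then show ?thesis
    using grid_action_Bij group_sym_wr_S2 group_BijGroup
    by (auto simp: group_action_def group_hom_def group_hom_axioms_def hom_def BijGroup_def)
qed

section \<open>Orbitals of the product action\<close>

lemma permutes_extends_pair:
  assumes "i \<in> S" "k \<in> S" "i' \<in> S" "k' \<in> S" "i = k \<longleftrightarrow> i' = k'"
  obtains \<sigma> where "\<sigma> permutes S" "\<sigma> i = i'" "\<sigma> k = k'"
proof -
  \<comment> \<open>The first transposition takes \<open>i\<close> to \<open>i'\<close> and
    \<open>k\<close> to \<open>?k\<close>; the second corrects \<open>?k\<close> to
    \<open>k'\<close>. If \<open>i\<close> and \<open>k\<close> differ, neither \<open>?k\<close>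
    nor \<open>k'\<close> equals \<open>i'\<close>, so \<open>i'\<close> stays put; if they
    coincide, the second transposition is the identity.\<close>
  let ?k = "transpose i i' k"
  let ?\<sigma> = "transpose ?k k' \<circ> transpose i i'"
  have "?k \<in> S" using assms(1-4) by (auto simp: transpose_def)
  then have "?\<sigma> permutes S"
    using assms(1-4) by (intro permutes_compose permutes_swap_id)
  moreover have "?\<sigma> i = i'" "?\<sigma> k = k'"
    using assms(5) by (auto simp: transpose_def)
  ultimately show thesis by (rule that)
qed

text \<open>The orbitals are the diagonal, the collinear pairs and the non-collinear pairs. A
  suitable \<open>h\<close> makes the two pairs agree in the same coordinates, after which the
  permutations of the two coordinates can be chosen independently.\<close>

lemma grid_orbital_transitive:
  assumes grid: "p \<in> grid m" "q \<in> grid m" "p' \<in> grid m" "q' \<in> grid m"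
    and ne: "p = q \<longleftrightarrow> p' = q'" and col: "collinear p q \<longleftrightarrow> collinear p' q'"
  shows "\<exists>x\<in>carrier (sym_wr_S2 m). grid_action m x p = p' \<and> grid_action m x q = q'"
proof -
  obtain h where h: "h permutes {1..2::nat}"
    "fst (swap_coords h p) = fst (swap_coords h q) \<longleftrightarrow> fst p' = fst q'"
    "snd (swap_coords h p) = snd (swap_coords h q) \<longleftrightarrow> snd p' = snd q'"
  proof (cases "(fst p = fst q \<longleftrightarrow> fst p' = fst q') \<and> (snd p = snd q \<longleftrightarrow> snd p' = snd q')")
    case True
    then show thesis
      by (intro that[of id]) (auto simp: swap_coords_def permutes_id)
  next
    case False
    \<comment> \<open>Only one situation is left: both pairs are distinct and collinear, one sharing
      its first coordinate and the other its second. Exchanging the coordinates repairs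
      this.\<close>
    then have "fst p = fst q \<longleftrightarrow> snd p' = snd q'" "snd p = snd q \<longleftrightarrow> fst p' = fst q'"
      using ne col by (auto simp: collinear_def prod_eq_iff)
    then show thesis
      by (intro that[of "transpose 1 2"] permutes_swap_id) (auto simp: swap_coords_def)
  qed
  let ?p = "swap_coords h p" and ?q = "swap_coords h q"
  have in_grid: "fst ?p \<in> {1..m}" "fst ?q \<in> {1..m}" "snd ?p \<in> {1..m}" "snd ?q \<in> {1..m}"
    "fst p' \<in> {1..m}" "fst q' \<in> {1..m}" "snd p' \<in> {1..m}" "snd q' \<in> {1..m}"
    using grid by (auto simp: swap_coords_def grid_def)
  obtain \<sigma> where \<sigma>: "\<sigma> permutes {1..m}" "\<sigma> (fst ?p) = fst p'" "\<sigma> (fst ?q) = fst q'"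
    using permutes_extends_pair[OF in_grid(1,2,5,6) h(2)] by blast
  obtain \<tau> where \<tau>: "\<tau> permutes {1..m}" "\<tau> (snd ?p) = snd p'" "\<tau> (snd ?q) = snd q'"
    using permutes_extends_pair[OF in_grid(3,4,7,8) h(3)] by blast
  have "((\<sigma>, \<tau>), h) \<in> carrier (sym_wr_S2 m)"
    using \<sigma> \<tau> h by (simp add: sym_wr_S2_carrier)
  moreover have "grid_map ((\<sigma>, \<tau>), h) p = p'" "grid_map ((\<sigma>, \<tau>), h) q = q'"
    using \<sigma> \<tau> by (simp_all add: grid_map_def prod_eq_iff)
  ultimately show ?thesis
    using grid by (metis grid_action_def restrict_apply')
qed

lemma collinear_grid_action:
  assumes "x \<in> carrier (sym_wr_S2 m)" "p \<in> grid m" "q \<in> grid m"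
  shows "collinear (grid_action m x p) (grid_action m x q) \<longleftrightarrow> collinear p q"
proof -
  obtain \<sigma> \<tau> h where x: "x = ((\<sigma>, \<tau>), h)" by (metis surj_pair)
  then have "inj \<sigma>" "inj \<tau>"
    using assms by (auto simp: sym_wr_S2_carrier intro: permutes_inj)
  then show ?thesis
    using assms by (auto simp: x grid_action_def grid_map_def collinear_def swap_coords_def inj_eq)
qed

lemma faithful_action_grid:
  assumes m: "m \<ge> 2"
  shows "faithful_action (sym_wr_S2 m) (grid m) (grid_action m)"
proof -
  interpret group_action "sym_wr_S2 m" "grid m" "grid_action m" by (rule group_action_grid)
  let ?W = "sym_wr_S2 m"
  have "x = \<one>\<^bsub>?W\<^esub>"
    if x: "x \<in> carrier ?W" and id: "\<And>p. p \<in> grid m \<Longrightarrow> grid_action m x p = p" for x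
  proof -
    obtain \<sigma> \<tau> h where xe: "x = ((\<sigma>, \<tau>), h)" by (metis surj_pair)
    then have perm: "\<sigma> permutes {1..m}" "\<tau> permutes {1..m}" "h permutes {1..2}"
      using x by (auto simp: sym_wr_S2_carrier)
    have eq: "map_prod \<sigma> \<tau> (swap_coords h (i, j)) = (i, j)" if "i \<in> {1..m}" "j \<in> {1..m}" for i j
      using id[of "(i, j)"] that by (simp add: xe grid_action_def grid_map_def grid_def)
    \<comment> \<open>If \<open>h\<close> exchanged the coordinates, fixing (1, 1) would force
      \<open>\<sigma> 1 = 1\<close>, while fixing (2, 1) would force
      \<open>\<sigma> 1 = 2\<close>.\<close>
    have h1: "h 1 = 1"
      using eq[of 1 1] eq[of 2 1] m by (auto simp: swap_coords_def split: if_splits)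
    have "h = id"
    proof (rule permutes_two_cases[OF perm(3)])
      assume "h 1 = 1" "h 2 = 2"
      moreover have "{1..2} = {1, 2::nat}" by auto
      ultimately show "h = id"
        using permutes_not_in[OF perm(3)] by (metis eq_id_iff insert_iff singletonD)
    qed (use h1 in simp)
    \<comment> \<open>With \<open>h\<close> trivial, the diagonal point (i, i) already determines
      both values; outside the range the permutations are the identity.\<close>
    moreover have "\<sigma> i = i" "\<tau> i = i" for i
      using eq[of i i] h1 perm(1,2)[THEN permutes_not_in, of i]
      by (cases "i \<in> {1..m}"; simp add: swap_coords_def)+
    then have "\<sigma> = id" "\<tau> = id" by auto
    ultimately show ?thesis
      by (simp add: xe sym_wr_S2_def semidirect_product_def sym_group_one)
  qed
  then have "kernel ?W (BijGroup (grid m)) (grid_action m) \<subseteq> {\<one>\<^bsub>?W\<^esub>}"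
    by (auto simp: kernel_def BijGroup_def)
  moreover have "\<one>\<^bsub>?W\<^esub> \<in> kernel ?W (BijGroup (grid m)) (grid_action m)"
    using group_hom group_hom.hom_one group_sym_wr_S2
    by (fastforce simp: kernel_def intro: group.is_monoid monoid.one_closed)
  ultimately show ?thesis
    using group_hom.inj_iff_trivial_ker[OF group_hom] group_action_axioms
    by (auto simp: faithful_action_def faithful_action_axioms_def)
qed

text \<open>An invariant partition with two distinct related points relates all collinear pairs or all
  non-collinear pairs. In both cases two steps connect any two points; the third row and column
  are needed for the non-collinear steps.\<close>

lemma primitive_action_grid:
  assumes m: "m \<ge> 3"
  shows "primitive_action (sym_wr_S2 m) (grid m) (grid_action m)"
proof -
  interpret group_action "sym_wr_S2 m" "grid m" "grid_action m" by (rule group_action_grid)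
  let ?W = "sym_wr_S2 m"
  \<comment> \<open>Point-transitivity is the case of the diagonal orbital.\<close>
  have trans: "\<exists>g\<in>carrier ?W. grid_action m g p = q" if "p \<in> grid m" "q \<in> grid m" for p q
    using grid_orbital_transitive[of p m p q q] that by (auto simp: collinear_def)
  have third: "\<exists>k\<in>{1..m}. k \<noteq> i \<and> k \<noteq> j" for i j
  proof -
    have "card ({1..m} - {i, j}) \<ge> card {1..m} - card {i, j}" by (rule diff_card_le_card_Diff) simp
    moreover have "card {i, j} \<le> 2" by (simp add: card_insert_if)
    ultimately have "card ({1..m} - {i, j}) > 0" using m by simp
    then show ?thesis by (metis Diff_iff card_gt_0_iff ex_in_conv insertCI)
  qed
  have prim: "Q = {grid m} \<or> Q = (\<lambda>x. {x}) ` grid m"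
    if Q: "partition_on (grid m) Q"
      and inv: "\<And>g X. g \<in> carrier ?W \<Longrightarrow> X \<in> Q \<Longrightarrow> grid_action m g ` X \<in> Q" for Q
  proof -
    \<comment> \<open>\<open>R\<close> is the equivalence relation of the partition; by
      \<open>R_orbital\<close> below, it contains a whole orbital as soon as it contains one pair of
      it.\<close>
    define R where "R p q \<longleftrightarrow> (\<exists>X\<in>Q. p \<in> X \<and> q \<in> X)" for p q
    have sub: "X \<subseteq> grid m" if "X \<in> Q" for X
      using partition_onD1[OF Q] that by blast
    have uniq: "X = Y" if "X \<in> Q" "Y \<in> Q" "p \<in> X" "p \<in> Y" for X Y p
      using partition_onD2[OF Q] that by (auto simp: disjoint_def)
    have R_trans: "R p q \<Longrightarrow> R q r \<Longrightarrow> R p r" for p q r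
      unfolding R_def using uniq by blast
    have R_orbital: "R p' q'"
      if prems: "R p q" "p \<noteq> q" "p' \<in> grid m" "q' \<in> grid m" "p' \<noteq> q'" "collinear p q \<longleftrightarrow> collinear p' q'"
      for p q p' q'
    proof -
      obtain X where X: "X \<in> Q" "p \<in> X" "q \<in> X" using \<open>R p q\<close> by (auto simp: R_def)
      then have "p \<in> grid m" "q \<in> grid m" using sub by blast+
      then obtain g where g: "g \<in> carrier ?W" "grid_action m g p = p'" "grid_action m g q = q'"
        using grid_orbital_transitive[OF _ _ prems(3,4) _ prems(6)] prems(2,5) by blast
      have "p' \<in> grid_action m g ` X" "q' \<in> grid_action m g ` X"
        using imageI[OF X(2), of "grid_action m g"] imageI[OF X(3), of "grid_action m g"] g(2,3)
        by simp_all
      with inv[OF g(1) X(1)] show ?thesis unfolding R_def by (intro bexI conjI)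
    qed
    show ?thesis
    proof (cases "\<exists>p q. R p q \<and> p \<noteq> q")
      case True
      then obtain p q where pq: "R p q" "p \<noteq> q" by blast
      have full: "R u v" if uv: "u \<in> grid m" "v \<in> grid m" "u \<noteq> v" for u v
      proof (cases "collinear p q \<longleftrightarrow> collinear u v")
        case True
        then show ?thesis using R_orbital[OF pq uv] by blast
      next
        case differ: False
        have "\<exists>w\<in>grid m. w \<noteq> u \<and> w \<noteq> v \<and>
            (collinear p q \<longleftrightarrow> collinear u w) \<and> (collinear p q \<longleftrightarrow> collinear w v)"
        proof (cases "collinear u v")
          case False
          with differ uv show ?thesis
            \<comment> \<open>A corner of the rectangle spanned by \<open>u\<close> and
              \<open>v\<close>: it shares one coordinate with each of them.\<close>
            by (intro bexI[of _ "(fst u, snd v)"]) (auto simp: collinear_def grid_def)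
        next
          case True
          obtain i j where "i \<in> {1..m}" "i \<noteq> fst u" "i \<noteq> fst v"
            and "j \<in> {1..m}" "j \<noteq> snd u" "j \<noteq> snd v"
            using third by metis
          with True differ show ?thesis
            by (intro bexI[of _ "(i, j)"]) (auto simp: collinear_def grid_def)
        qed
        then obtain w where w: "w \<in> grid m" "w \<noteq> u" "w \<noteq> v"
          "collinear p q \<longleftrightarrow> collinear u w" "collinear p q \<longleftrightarrow> collinear w v" by blast
        have "R u w" using R_orbital[OF pq uv(1) w(1)] w by simp
        moreover have "R w v" using R_orbital[OF pq w(1) uv(2)] w by simp
        ultimately show ?thesis by (rule R_trans)
      qed
      obtain X where X: "X \<in> Q" "p \<in> X" using pq by (auto simp: R_def)
      then have p: "p \<in> grid m" using sub by blast
      have X_full: "X = grid m"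
      proof
        show "grid m \<subseteq> X"
        proof
          fix v assume v: "v \<in> grid m"
          show "v \<in> X"
          proof (cases "v = p")
            case False
            then obtain Y where "Y \<in> Q" "p \<in> Y" "v \<in> Y"
              using full[OF p v] by (auto simp: R_def)
            then show ?thesis using uniq X by blast
          qed (use X in simp)
        qed
      qed (rule sub[OF X(1)])
      have "Y = X" if Y: "Y \<in> Q" for Y
      proof -
        obtain y where "y \<in> Y" using partition_onD3[OF Q] Y by (metis ex_in_conv)
        moreover from this have "y \<in> X" using sub[OF Y] X_full by blast
        ultimately show ?thesis using uniq[OF Y X(1)] by blast
      qed
      then show ?thesis using X(1) X_full by blast
    next
      case False
      then have single: "X = {x}" if "X \<in> Q" "x \<in> X" for X x
        using False that unfolding R_def by blast
      have "Q = (\<lambda>x. {x}) ` grid m"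
      proof (intro equalityI subsetI)
        fix X assume X: "X \<in> Q"
        then obtain x where "x \<in> X" using partition_onD3[OF Q] by (metis ex_in_conv)
        then show "X \<in> (\<lambda>x. {x}) ` grid m" using single X sub by blast
      next
        fix X assume "X \<in> (\<lambda>x. {x}) ` grid m"
        then obtain x where "x \<in> grid m" "X = {x}" by blast
        moreover from this obtain Y where "Y \<in> Q" "x \<in> Y" using partition_onD1[OF Q] by blast
        ultimately show "X \<in> Q" using single by metis
      qed
      then show ?thesis ..
    qed
  qed
  show ?thesis
    using group_action_axioms trans prim
    unfolding primitive_action_def primitive_action_axioms_def transitive_action_def
      transitive_action_axioms_def by blast
qed

section \<open>The staircase design\<close>

definition orbital :: "nat \<Rightarrow> bool \<Rightarrow> ((nat \<times> nat) \<times> (nat \<times> nat)) set" where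
  "orbital m c = {(p, q) \<in> grid m \<times> grid m. p \<noteq> q \<and> (collinear p q \<longleftrightarrow> c)}"

text \<open>The lattice path (1,1), (1,2), (2,2), (2,3), (3,3), ..., whose steps alternately raise
  the second and the first coordinate.\<close>

definition stair :: "nat \<Rightarrow> nat \<times> nat" where
  "stair t = (1 + t div 2, 1 + (t + 1) div 2)"

definition staircase :: "nat \<Rightarrow> (nat \<times> nat) set" where
  "staircase m = stair ` {..m}"

section \<open>Pair counts in the grid and on the staircase\<close>

lemma card_orbital_collinear: "card (orbital m True) = 2 * m ^ 2 * (m - 1)"
proof -
  have "orbital m True = Sigma (grid m) (\<lambda>p. {fst p} \<times> ({1..m} - {snd p}) \<union>
      ({1..m} - {fst p}) \<times> {snd p})"
    by (auto simp: orbital_def collinear_def grid_def)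
  moreover have "card ({fst p} \<times> ({1..m} - {snd p}) \<union> ({1..m} - {fst p}) \<times> {snd p}) = 2 * (m - 1)"
    if "p \<in> grid m" for p
    using that by (subst card_Un_disjoint) (auto simp: grid_def card_cartesian_product)
  ultimately show ?thesis
    by (simp add: finite_grid card_grid)
qed

lemma card_orbital_noncollinear: "card (orbital m False) = m ^ 2 * (m - 1) ^ 2"
proof -
  have "orbital m False = Sigma (grid m) (\<lambda>p. ({1..m} - {fst p}) \<times> ({1..m} - {snd p}))"
    by (auto simp: orbital_def collinear_def grid_def)
  moreover have "card (({1..m} - {fst p}) \<times> ({1..m} - {snd p})) = (m - 1) ^ 2"
    if "p \<in> grid m" for p
    using that by (auto simp: grid_def card_cartesian_product power2_eq_square)
  ultimately show ?thesis
    by (simp add: finite_grid card_grid)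
qed

text \<open>The coordinates of \<open>stair t\<close> add up to t + 2, so the point determines
  \<open>t\<close>.\<close>

lemma inj_stair: "inj stair"
proof (rule injI)
  fix t u assume "stair t = stair u"
  then have "t div 2 = u div 2" "(t + 1) div 2 = (u + 1) div 2" by (simp_all add: stair_def)
  moreover have "n div 2 + (n + 1) div 2 = n" for n :: nat by linarith
  ultimately show "t = u" by metis
qed

text \<open>First coordinates agree exactly within the index pairs {2a, 2a + 1}, second coordinates
  exactly within {2a - 1, 2a}; so distinct collinear points have consecutive indices.\<close>

lemma collinear_stair:
  assumes "t \<noteq> u"
  shows "collinear (stair t) (stair u) \<longleftrightarrow> u = t + 1 \<or> t = u + 1"
  using assms by (cases "even t"; cases "even u")
    (auto simp: collinear_def stair_def elim!: evenE oddE)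

lemma card_staircase: "card (staircase m) = m + 1"
  using card_image[OF inj_on_subset[OF inj_stair subset_UNIV]] by (simp add: staircase_def)

text \<open>The largest coordinate is 1 + (m + 1) div 2, which is at most m once m is at least
  2.\<close>

lemma staircase_subset:
  assumes "m \<ge> 2"
  shows "staircase m \<subseteq> grid m"
proof -
  have "stair t \<in> grid m" if "t \<le> m" for t
    using that assms by (auto simp: stair_def grid_def)
  then show ?thesis by (auto simp: staircase_def)
qed

lemma card_staircase_collinear:
  assumes "m \<ge> 2"
  shows "card (orbital m True \<inter> staircase m \<times> staircase m) = 2 * m"
proof -
  \<comment> \<open>The indices 0, ..., m have m consecutive pairs, each taken in both
    orders.\<close>
  let ?A = "(\<lambda>t. (t, t + 1)) ` {..<m}" and ?B = "(\<lambda>t. (t + 1, t)) ` {..<m}"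
  have "orbital m True \<inter> staircase m \<times> staircase m = map_prod stair stair ` (?A \<union> ?B)"
  proof (intro equalityI subsetI)
    fix z assume z: "z \<in> orbital m True \<inter> staircase m \<times> staircase m"
    then obtain t u where tu: "t \<le> m" "u \<le> m" "z = (stair t, stair u)"
      by (auto simp: staircase_def)
    then have "t \<noteq> u" "collinear (stair t) (stair u)" using z by (auto simp: orbital_def)
    then have "u = t + 1 \<or> t = u + 1" using collinear_stair by blast
    then have "(t, u) \<in> ?A \<union> ?B" using tu by auto
    then show "z \<in> map_prod stair stair ` (?A \<union> ?B)" using tu(3) by force
  next
    fix z assume "z \<in> map_prod stair stair ` (?A \<union> ?B)"
    then obtain t u where tu: "(t, u) \<in> ?A \<union> ?B" "z = (stair t, stair u)" by auto
    then have "t \<le> m" "u \<le> m" "t \<noteq> u" "u = t + 1 \<or> t = u + 1" by auto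
    then have "stair t \<in> staircase m" "stair u \<in> staircase m" "stair t \<noteq> stair u"
      "collinear (stair t) (stair u)"
      using collinear_stair inj_stair by (auto simp: staircase_def inj_eq)
    then show "z \<in> orbital m True \<inter> staircase m \<times> staircase m"
      using tu(2) staircase_subset[OF assms] by (auto simp: orbital_def)
  qed
  moreover have "inj (map_prod stair stair)"
    using inj_stair by (simp add: prod.inj_map)
  moreover have "card (?A \<union> ?B) = 2 * m"
    by (subst card_Un_disjoint) (auto simp: card_image inj_on_def)
  ultimately show ?thesis
    using card_image[OF inj_on_subset[OF _ subset_UNIV], of "map_prod stair stair" "?A \<union> ?B"]
    by simp
qed

text \<open>What remains of the (m + 1)^2 ordered pairs after removing m + 1 diagonal and 2m
  collinear ones.\<close>

lemma card_staircase_noncollinear: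
  assumes "m \<ge> 2"
  shows "card (orbital m False \<inter> staircase m \<times> staircase m) = m * (m - 1)"
proof -
  let ?b = "staircase m"
  define C where "C c = orbital m c \<inter> ?b \<times> ?b" for c
  have fin: "finite ?b" by (simp add: staircase_def)
  have split: "?b \<times> ?b = Id_on ?b \<union> (C True \<union> C False)"
    using staircase_subset[OF assms] by (auto simp: C_def orbital_def)
  have "finite (?b \<times> ?b)" using fin by simp
  then have "finite (Id_on ?b)" "finite (C True)" "finite (C False)"
    unfolding split by simp_all
  moreover have "Id_on ?b \<inter> (C True \<union> C False) = {}" "C True \<inter> C False = {}"
    by (auto simp: C_def orbital_def)
  ultimately have "card (?b \<times> ?b) = card (Id_on ?b) + (card (C True) + card (C False))"
    unfolding split by (simp only: card_Un_disjoint finite_Un simp_thms)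
  moreover have "card (Id_on ?b) = m + 1"
  proof -
    have "Id_on ?b = (\<lambda>x. (x, x)) ` ?b" by auto
    then show ?thesis by (simp add: card_image inj_on_def card_staircase)
  qed
  ultimately have "(m + 1) * (m + 1) = (m + 1) + (2 * m + card (C False))"
    using card_staircase_collinear[OF assms] by (simp flip: C_def add: card_cartesian_product card_staircase)
  moreover have "(m + 1) * (m + 1) = (m + 1) + (2 * m + m * (m - 1))"
    by (cases m) simp_all
  ultimately show ?thesis by (simp add: C_def)
qed

abbreviation staircase_blocks :: "nat \<Rightarrow> (nat \<times> nat) set set" where
  "staircase_blocks m \<equiv> group_action.block_orbit (sym_wr_S2 m) (grid_action m) (staircase m)"

text \<open>The staircase meets both orbitals in the same proportion, since
  \<open>2m : 2m\<^sup>2(m - 1) = m(m - 1) : m\<^sup>2(m - 1)\<^sup>2\<close>.\<close>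

lemma staircase_pair_count:
  assumes m: "m \<ge> 2" and pq: "p \<in> grid m" "q \<in> grid m" "p \<noteq> q"
  shows "card {c \<in> staircase_blocks m. {p, q} \<subseteq> c} * (m * (m - 1)) = card (staircase_blocks m)"
proof -
  interpret group_action "sym_wr_S2 m" "grid m" "grid_action m" by (rule group_action_grid)
  let ?l = "card {c \<in> staircase_blocks m. {p, q} \<subseteq> c}" and ?n = "card (staircase_blocks m)"
  let ?c = "collinear p q"
  have inv: "map_prod (grid_action m g) (grid_action m g) ` orbital m c \<subseteq> orbital m c"
    if g: "g \<in> carrier (sym_wr_S2 m)" for g c
  proof (rule image_subsetI)
    fix z assume "z \<in> orbital m c"
    then obtain x y where z: "z = (x, y)" and xy: "(x, y) \<in> orbital m c" by (cases z) simp
    then have "x \<in> grid m" "y \<in> grid m" by (auto simp: orbital_def)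
    moreover from this have "grid_action m g x \<in> grid m" "grid_action m g y \<in> grid m"
      using element_image[OF g] by auto
    ultimately show "map_prod (grid_action m g) (grid_action m g) z \<in> orbital m c"
      unfolding z using xy collinear_grid_action[OF g] inj_prop[OF g] by (auto simp: orbital_def inj_on_eq_iff)
  qed
  have trans: "\<exists>g\<in>carrier (sym_wr_S2 m). map_prod (grid_action m g) (grid_action m g) z = w"
    if "z \<in> orbital m c" "w \<in> orbital m c" for z w c
  proof -
    have "\<exists>g\<in>carrier (sym_wr_S2 m). grid_action m g (fst z) = fst w \<and> grid_action m g (snd z) = snd w"
      using that by (intro grid_orbital_transitive) (auto simp: orbital_def)
    then show ?thesis by (metis map_prod_simp prod.collapse)
  qed
  have count: "?l * card (orbital m ?c) = ?n * card (orbital m ?c \<inter> staircase m \<times> staircase m)"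
    using pq by (intro orbital_count finite_grid staircase_subset m inv trans)
      (auto simp: orbital_def)
  show ?thesis
  proof (cases ?c)
    case True
    then have "?l * (2 * m ^ 2 * (m - 1)) = ?n * (2 * m)"
      using count by (simp only: card_orbital_collinear card_staircase_collinear[OF m])
    \<comment> \<open>The count is regrouped so that the factor 2m, which is positive, cancels
      without any division.\<close>
    then have "(?l * (m * (m - 1))) * (2 * m) = ?n * (2 * m)"
      by (simp only: power2_eq_square ac_simps)
    then show ?thesis using m by simp
  next
    case False
    then have "?l * (m ^ 2 * (m - 1) ^ 2) = ?n * (m * (m - 1))"
      using count by (simp only: card_orbital_noncollinear card_staircase_noncollinear[OF m])
    then have "(?l * (m * (m - 1))) * (m * (m - 1)) = ?n * (m * (m - 1))"
      by (simp only: power2_eq_square ac_simps)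
    then show ?thesis using m by simp
  qed
qed

lemma two_design_staircase:
  assumes m: "m \<ge> 2"
  shows "\<exists>l. two_design (m ^ 2) (m + 1) l (grid m) (staircase_blocks m)"
proof -
  interpret group_action "sym_wr_S2 m" "grid m" "grid_action m" by (rule group_action_grid)
  \<comment> \<open>This is the usual value |B| k(k - 1) / (v(v - 1)) for v = m^2 and k = m + 1. The
    division is exact by \<open>staircase_pair_count\<close>.\<close>
  define l where "l = card (staircase_blocks m) div (m * (m - 1))"
  have sub: "staircase m \<subseteq> grid m" by (rule staircase_subset[OF m])
  have mm: "m * (m - 1) > 0" using m by simp
  have pairs: "card {c \<in> staircase_blocks m. {p, q} \<subseteq> c} = l"
    if "p \<in> grid m" "q \<in> grid m" "p \<noteq> q" for p q
    unfolding l_def staircase_pair_count[OF m that, symmetric] using mm by simp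
  have "staircase_blocks m \<subseteq> Pow (grid m)"
    using block_orbit_subset[OF sub] by blast
  then have "finite (staircase_blocks m)"
    using finite_grid by (meson finite_Pow_iff finite_subset)
  then have "card (staircase_blocks m) > 0"
    using block_orbit_refl[OF sub] by (auto simp: card_gt_0_iff)
  \<comment> \<open>Any one pair of distinct points would do here; the equation and the non-empty
    orbit give positivity of \<open>l\<close>.\<close>
  moreover have "l * (m * (m - 1)) = card (staircase_blocks m)"
    using staircase_pair_count[OF m, of "(1, 1)" "(1, 2)"] pairs[of "(1, 1)" "(1, 2)"] m
    by (simp add: grid_def)
  ultimately have "l > 0" by (metis gr0I mult_0 less_irrefl)
  moreover have "card {c \<in> staircase_blocks m. S \<subseteq> c} = l" if S: "S \<subseteq> grid m" "card S = 2" for S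
  proof -
    obtain p q where "S = {p, q}" "p \<noteq> q" using S(2) by (auto simp: card_2_iff)
    then show ?thesis using pairs[of p q] S(1) by simp
  qed
  ultimately show ?thesis
    using m finite_grid card_grid block_orbit_subset[OF sub] card_block_orbit_member[OF sub]
      card_staircase
    by (auto simp: two_design_def)
qed

theorem corollary4p3:
  fixes m :: nat
  assumes "m \<ge> 3"
  shows "\<exists>(P :: nat set) B l G.
           two_design (m ^ 2) (m + 1) l P B \<and>
           automorphism_group P B G \<and>
           perm_group P G \<cong> sym_wr_S2 m \<and>
           block_transitive P B G \<and>
           point_primitive P G"
proof -
  let ?W = "sym_wr_S2 m"
  \<comment> \<open>\<open>prod_encode\<close> is the injective pairing function on natural numbers;
    it supplies the point set in \<open>nat\<close> that the statement asks for.\<close>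
  define P where "P = prod_encode ` grid m"
  define \<psi> where "\<psi> = transport_action prod_encode (grid m) (grid_action m)"
  define b where "b = prod_encode ` staircase m"
  have m: "m \<ge> 2" using assms by simp
  have e: "inj_on prod_encode (grid m)" by (rule inj_prod_encode)
  have sub: "staircase m \<subseteq> grid m" by (rule staircase_subset[OF m])
  then have b: "b \<subseteq> P" by (auto simp: b_def P_def)
  interpret faithful_action ?W P \<psi>
    unfolding P_def \<psi>_def by (rule faithful_action_transport[OF faithful_action_grid[OF m] e])
  interpret primitive_action ?W P \<psi>
    unfolding P_def \<psi>_def by (rule primitive_action_transport[OF primitive_action_grid[OF assms] e])
  obtain l where "two_design (m ^ 2) (m + 1) l (grid m) (staircase_blocks m)"
    using two_design_staircase[OF m] by blast
  from two_design_transport[OF this e]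
  have "two_design (m ^ 2) (m + 1) l P (block_orbit b)"
    unfolding P_def \<psi>_def b_def block_orbit_transport[OF group_action_grid e sub] .
  then show ?thesis
    using automorphism_group_block_orbit[OF b] perm_group_image_iso
      block_transitive_block_orbit[OF b] point_primitive_image by blast
qed

end
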